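(* Consider the output map from the state space $(SO(n))^k$ (resp. $(\mathbb{R}^n)^k$) to the output space $(S^{n-1})^{2\#\mathcal{E}}$ (resp. $\mathbb{R}^{2\#\mathcal{E}}$), with fixed reference vectors $y_{ij}=y_{ji}\in S^{n-1}$, $(i,j)\in\mathcal{E}$. The output map is injective if and only if each vertex $i\in\mathcal{V}$ has at least $n-1$ (resp. $n$) linearly independent vectors among the $y_{ij}$ with $a_{ij}=1$. If injectivity is not satisfied, then for any $(Q_1,\ldots,Q_k)$ in $C_o$ there is a continuum of states in $C_o\setminus C_s$ giving the same output as $(Q_1,\ldots,Q_k)$.
   Context: $\mathcal{G}(\mathcal{V},\mathcal{E})$ is an undirected finite graph without self-loops, $\mathcal{V}=\{1,\ldots,k\}$, $k>2$; $a_{ij}=1$ if $(i,j)\in\mathcal{E}$ and $a_{ij}=0$ otherwise; $(i,j)$ denotes the unordered pair. $S^{n-1}$ is the unit sphere of $\mathbb{R}^n$; $n\ge2$ for $SO(n)$ and $n\ge1$ for $\mathbb{R}^n$. On $SO(n)$ the output map sends $(Q_1,\ldots,Q_k)$ to the collection of all pairs $(Q_i^Ty_{ij},\,Q_j^Ty_{ij})$, $(i,j)\in\mathcal{E}$. On $\mathbb{R}^n$ the output map sends $(x_1,\ldots,x_k)$ to the collection of all pairs $(x_i^Ty_{ij},\,x_j^Ty_{ij})$, $(i,j)\in\mathcal{E}$. State synchronization set: $C_s=\{(Q_1,\ldots,Q_k)\in(SO(n))^k: Q_1=\cdots=Q_k\}$. Output synchronization set: $C_o=\{(Q_1,\ldots,Q_k)\in(SO(n))^k: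 Q_i^Ty_{ij}=Q_j^Ty_{ij}\ \forall(i,j)\in\mathcal{E}\}$. *)

theory Defs
  imports "HOL-Analysis.Analysis"
begin

text \<open>
  The vertices are the elements of a finite type \<open>'k\<close>, and a state assigns to every vertex a
  matrix in \<open>real^'n^'n\<close> or a vector in \<open>real^'n\<close>. A graph is given by its set of undirected
  edges \<open>{i, j}\<close>.
\<close>

definition simple_graph :: "'k set set \<Rightarrow> bool"
  where "simple_graph E \<longleftrightarrow> (\<forall>e\<in>E. card e = 2)"

definition darts :: "'k set set \<Rightarrow> ('k \<times> 'k) set"
  where "darts E = {(i, j). {i, j} \<in> E}"

definition neighbours :: "'k set set \<Rightarrow> 'k \<Rightarrow> 'k set"
  where "neighbours E i = {j. {i, j} \<in> E}"

definition SO_states :: "((real^'n^'n)^'k) set"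
  where "SO_states = {Q. \<forall>i. rotation_matrix (Q $ i)}"

text \<open>
  The pair of vectors that an edge \<open>{i, j}\<close> contributes to the output is stored in the components
  \<open>(i, j)\<close> and \<open>(j, i)\<close>, so an output has \<open>2 * card E\<close> components.
\<close>

definition output_SO ::
    "'k set set \<Rightarrow> ('k \<Rightarrow> 'k \<Rightarrow> real^'n) \<Rightarrow> (real^'n^'n)^'k \<Rightarrow> 'k \<times> 'k \<Rightarrow> real^'n"
  where "output_SO E y Q = (\<lambda>(i, j)\<in>darts E. transpose (Q $ i) *v y i j)"

definition output_R ::
    "'k set set \<Rightarrow> ('k \<Rightarrow> 'k \<Rightarrow> real^'n) \<Rightarrow> (real^'n)^'k \<Rightarrow> 'k \<times> 'k \<Rightarrow> real"
  where "output_R E y x = (\<lambda>(i, j)\<in>darts E. (x $ i) \<bullet> y i j)"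

definition state_sync :: "((real^'n^'n)^'k) set"
  where "state_sync = {Q \<in> SO_states. \<forall>i j. Q $ i = Q $ j}"

definition output_sync :: "'k set set \<Rightarrow> ('k \<Rightarrow> 'k \<Rightarrow> real^'n) \<Rightarrow> ((real^'n^'n)^'k) set"
  where "output_sync E y =
    {Q \<in> SO_states. \<forall>i j. {i, j} \<in> E \<longrightarrow>
      transpose (Q $ i) *v y i j = transpose (Q $ j) *v y i j}"

definition has_indep_vectors ::
    "'k set set \<Rightarrow> ('k \<Rightarrow> 'k \<Rightarrow> real^'n) \<Rightarrow> nat \<Rightarrow> 'k \<Rightarrow> bool"
  where "has_indep_vectors E y m i \<longleftrightarrow>
    (\<exists>B \<subseteq> y i ` neighbours E i. independent B \<and> card B \<ge> m)"

lemma card_darts: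
  fixes E :: "'k::finite set set"
  assumes "simple_graph E"
  shows "card (darts E) = 2 * card E"
proof -
  let ?D = "\<lambda>e. {(i, j). {i, j} = e}"
  have "darts E = (\<Union>e\<in>E. ?D e)"
    by (auto simp: darts_def)
  moreover have "card (\<Union>e\<in>E. ?D e) = (\<Sum>e\<in>E. card (?D e))"
    by (rule card_UN_disjoint) auto
  moreover have "card (?D e) = 2" if "e \<in> E" for e
  proof -
    obtain a b where "e = {a, b}" "a \<noteq> b"
      using assms \<open>e \<in> E\<close> unfolding simple_graph_def card_2_iff by metis
    then have "?D e = {(a, b), (b, a)}"
      by (auto simp: doubleton_eq_iff)
    with \<open>a \<noteq> b\<close> show ?thesis by simp
  qed
  ultimately show ?thesis by simp
qed

lemma output_SO_in_spheres:
  fixes y :: "'k::finite \<Rightarrow> 'k \<Rightarrow> real^'n"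
  assumes "\<And>i j. {i, j} \<in> E \<Longrightarrow> norm (y i j) = 1"
  shows "output_SO E y \<in> SO_states \<rightarrow> (darts E \<rightarrow>\<^sub>E sphere 0 1)"
proof -
  have "norm (transpose A *v v) = norm v" if "rotation_matrix A" for A :: "real^'n^'n" and v
    using that orthogonal_transformation_norm[of "(*v) (transpose A)"]
    by (simp add: rotation_matrix_def orthogonal_transformation_matrix matrix_vector_mul_linear
        orthogonal_matrix_transpose)
  then show ?thesis
    using assms
    by (auto simp: output_SO_def SO_states_def darts_def PiE_iff extensional_def
        simp del: transpose_matrix_vector)
qed

end

theory Submission
  imports Defs
begin

text \<open>
  Everything is decided vertex by vertex by the span \<open>V\<^sub>i\<close> of the vectors \<open>y i j\<close>. Two rotations \<open>P\<close>,
  \<open>Q\<close> agree in all outputs at \<open>i\<close> iff \<open>Q P\<^sup>T\<close> fixes \<open>V\<^sub>i\<close> pointwise. A rotation fixing a hyperplane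
  pointwise maps the normal \<open>u\<close> to \<open>c u\<close> with \<open>c\<close> its determinant, so it is the identity. If
  \<open>dim V\<^sub>i \<le> n - 2\<close>, there are orthonormal \<open>u\<close>, \<open>w\<close> orthogonal to \<open>V\<^sub>i\<close>, and multiplying \<open>Q\<^sub>i\<close> on the
  left by the rotations of the plane spanned by \<open>u\<close> and \<open>w\<close> does not change the output. The other
  vertices keep their matrices, so synchronization would force the rotated matrix to equal a fixed
  one, which is avoided by a suitable interval of angles.
\<close>

section \<open>Dimension and orthogonal complements of the reference vectors\<close>

text \<open>A basis of the span can be chosen among the reference vectors themselves. The
  existential condition thereby becomes a bound on a dimension, the form used from here on.\<close>

lemma has_indep_vectors_iff_dim:
  fixes y :: "'k \<Rightarrow> 'k \<Rightarrow> real^'n"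
  shows "has_indep_vectors E y m i \<longleftrightarrow> m \<le> dim (y i ` neighbours E i)"
proof
  assume "has_indep_vectors E y m i"
  then obtain B where "B \<subseteq> y i ` neighbours E i" "independent B" "m \<le> card B"
    unfolding has_indep_vectors_def by blast
  then show "m \<le> dim (y i ` neighbours E i)"
    by (metis dim_eq_card_independent dim_subset order_trans)
next
  assume "m \<le> dim (y i ` neighbours E i)"
  then show "has_indep_vectors E y m i"
    unfolding has_indep_vectors_def by (metis basis_exists order_refl)
qed

lemma exists_unit_orthogonal:
  fixes V :: "(real^'n) set"
  assumes "dim V < CARD('n)"
  obtains u where "norm u = 1" "\<And>v. v \<in> V \<Longrightarrow> u \<bullet> v = 0"
proof -
  obtain x where x: "x \<noteq> 0" "\<And>v. v \<in> span V \<Longrightarrow> orthogonal x v"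
    using orthogonal_to_subspace_exists[of V] assms by auto
  show ?thesis
  proof (rule that)
    show "norm (x /\<^sub>R norm x) = 1"
      using x(1) by simp
    show "(x /\<^sub>R norm x) \<bullet> v = 0" if "v \<in> V" for v
      using x(2)[OF span_base[OF that]] by (simp add: orthogonal_def)
  qed
qed

lemma span_eq_UNIV_if_dim:
  fixes V :: "(real^'n) set"
  assumes "CARD('n) \<le> dim V"
  shows "span V = UNIV"
  using assms dim_subset_UNIV[of V] dim_eq_full[of V] by simp

lemma matrix_fixes_span:
  fixes M :: "real^'n^'n"
  assumes "\<And>v. v \<in> V \<Longrightarrow> M *v v = v" "x \<in> span V"
  shows "M *v x = x"
  using assms linear_eq_on_span[of "(*v) M" id V x]
  by (simp add: matrix_vector_mul_linear linear_id)

section \<open>Rotations fixing a hyperplane pointwise\<close>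

text \<open>In an orthonormal basis containing \<open>u\<close> the matrix is diagonal, with
  \<open>c\<close> at \<open>u\<close> and \<open>1\<close> elsewhere, and an orthogonal change of
  basis preserves the determinant.\<close>

lemma det_fixes_hyperplane:
  fixes M :: "real^'n^'n"
  assumes u: "norm u = 1" and Mu: "M *v u = c *\<^sub>R u"
    and fix_perp: "\<And>v. v \<bullet> u = 0 \<Longrightarrow> M *v v = v"
  shows "det M = c"
proof -
  \<comment> \<open>This only names some coordinate: any axis can be carried to
    \<open>u\<close>.\<close>
  obtain k :: 'n where True by simp
  obtain A where A: "orthogonal_matrix A" "A *v (axis k 1) = u"
    using orthogonal_matrix_exists_basis[OF u] by blast
  define B where "B = transpose A ** M ** A"
  have AtA: "transpose A ** A = mat 1"
    using A(1) by (simp add: orthogonal_matrix)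
  have detA: "det (transpose A) * det A = 1"
    using AtA by (metis det_I det_mul)
  have B_axis: "B *v axis j 1 = (if j = k then c else 1) *\<^sub>R axis j 1" for j
  proof -
    have At: "transpose A *v (A *v x) = x" for x
      using AtA by (metis matrix_vector_mul_assoc matrix_vector_mul_lid)
    \<comment> \<open>As \<open>A\<close> preserves inner products, its columns other than the
      \<open>k\<close>-th are orthogonal to \<open>u\<close> and hence fixed by
      \<open>M\<close>.\<close>
    have "(A *v axis j 1) \<bullet> u = axis j 1 \<bullet> axis k (1::real)"
      by (metis A At dot_lmul_matrix inner_commute transpose_matrix_vector)
    then have "j \<noteq> k \<Longrightarrow> (A *v axis j 1) \<bullet> u = 0"
      by (simp add: inner_axis_axis)
    then have "M *v (A *v axis j 1) = A *v ((if j = k then c else 1) *\<^sub>R axis j 1)"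
      using A(2) Mu fix_perp by (auto simp: matrix_vector_mult_scaleR)
    then show ?thesis
      unfolding B_def using At
      by (simp add: matrix_vector_mul_assoc[symmetric] del: transpose_matrix_vector)
  qed
  have B: "B $ i $ j = (if i = j then (if j = k then c else 1) else 0)" for i j
  proof -
    have "B $ i $ j = (B *v axis j 1) $ i"
      by (simp add: matrix_vector_mult_basis column_def)
    then show ?thesis
      unfolding B_axis by (simp add: axis_def)
  qed
  have "det B = (\<Prod>i\<in>UNIV. B $ i $ i)"
    by (rule det_diagonal) (simp add: B)
  also have "\<dots> = c"
    by (simp add: B prod.delta)
  finally have "det B = c" .
  moreover have "det B = det (transpose A) * det A * det M"
    by (simp add: B_def det_mul)
  ultimately show ?thesis
    using detA by simp
qed

lemma rotation_matrix_inner: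
  fixes M :: "real^'n^'n"
  assumes "rotation_matrix M"
  shows "(M *v x) \<bullet> (M *v y) = x \<bullet> y"
proof -
  have "orthogonal_transformation ((*v) M)"
    using assms by (simp add: rotation_matrix_def orthogonal_transformation_matrix
        matrix_vector_mul_linear)
  then show ?thesis
    by (simp add: orthogonal_transformation_def)
qed

lemma rotation_matrix_mult:
  fixes A B :: "real^'n^'n"
  shows "rotation_matrix A \<Longrightarrow> rotation_matrix B \<Longrightarrow> rotation_matrix (A ** B)"
  by (simp add: rotation_matrix_def orthogonal_matrix_mul det_mul)

lemma rotation_matrix_transpose:
  fixes A :: "real^'n^'n"
  shows "rotation_matrix A \<Longrightarrow> rotation_matrix (transpose A)"
  by (simp add: rotation_matrix_def)

lemma rotation_fixes_codim_1_eq_id: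
  fixes M :: "real^'n^'n"
  assumes rot: "rotation_matrix M" and fixV: "\<And>v. v \<in> V \<Longrightarrow> M *v v = v"
    and dim: "CARD('n) - 1 \<le> dim V"
  shows "M = mat 1"
proof -
  have fix_span: "M *v v = v" if "v \<in> span V" for v
    using matrix_fixes_span fixV that by blast
  have "M *v x = x" for x
  proof (cases "dim V < CARD('n)")
    case False
    then have "span V = UNIV"
      by (simp add: span_eq_UNIV_if_dim)
    then show ?thesis
      using fix_span by simp
  next
    case True
    then obtain u where u: "norm u = 1" "\<And>v. v \<in> V \<Longrightarrow> u \<bullet> v = 0"
      using exists_unit_orthogonal by blast
    have uu: "u \<bullet> u = 1"
      using u(1) by (simp add: norm_eq_1)
    \<comment> \<open>The span lies in the hyperplane normal to \<open>u\<close>, and the dimension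
      bound leaves no room for a proper inclusion.\<close>
    have "span V \<subseteq> {v. u \<bullet> v = 0}"
      using u(2) by (intro span_minimal subspace_hyperplane) auto
    moreover have "dim {v. u \<bullet> v = 0} = CARD('n) - 1"
      using u(1) dim_hyperplane[of u] by force
    ultimately have span_eq: "span V = {v. u \<bullet> v = 0}"
      using dim by (intro subspace_dim_equal) (auto simp: subspace_hyperplane)
    have fix_perp: "M *v v = v" if "v \<bullet> u = 0" for v
      using fix_span[of v] that by (simp add: span_eq inner_commute)
    define c where "c = (M *v u) \<bullet> u"
    \<comment> \<open>The part of \<open>M *v u\<close> orthogonal to \<open>u\<close>. It is fixed
      by \<open>M\<close>, so invariance of the inner product makes it orthogonal to
      \<open>M *v u\<close> as well, hence to itself.\<close>
    define w where "w = M *v u - c *\<^sub>R u"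
    have wu: "w \<bullet> u = 0"
      by (simp add: w_def inner_diff_left uu c_def)
    have "(M *v u) \<bullet> w = u \<bullet> w"
      using rotation_matrix_inner[OF rot, of u w] fix_perp[OF wu] by simp
    then have "(M *v u - c *\<^sub>R u) \<bullet> w = 0"
      using wu by (simp add: inner_diff_right inner_commute)
    then have "w \<bullet> w = 0"
      by (simp add: w_def)
    then have Mu: "M *v u = c *\<^sub>R u"
      by (simp add: w_def)
    then have "c = 1"
      using det_fixes_hyperplane[OF u(1) Mu fix_perp] rot by (simp add: rotation_matrix_def)
    define x' where "x' = x - (x \<bullet> u) *\<^sub>R u"
    have "M *v x' = x'"
      by (rule fix_perp) (simp add: x'_def inner_diff_left uu)
    then have "M *v (x' + (x \<bullet> u) *\<^sub>R u) = x' + (x \<bullet> u) *\<^sub>R u"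
      using Mu \<open>c = 1\<close> by (simp add: matrix_vector_right_distrib matrix_vector_mult_scaleR)
    then show ?thesis
      by (simp add: x'_def)
  qed
  then show ?thesis
    by (simp add: matrix_eq)
qed

section \<open>Rotations of a plane\<close>

text \<open>For orthonormal \<open>u\<close> and \<open>w\<close> this is the rotation by the angle
  \<open>t\<close> from \<open>u\<close> towards \<open>w\<close>, the identity on the orthogonal
  complement of their plane. The formula needs no completion to a basis.\<close>

definition plane_rotation :: "real^'n \<Rightarrow> real^'n \<Rightarrow> real \<Rightarrow> real^'n^'n"
  where "plane_rotation u w t = matrix (\<lambda>x. x
    + (cos t - 1) *\<^sub>R ((u \<bullet> x) *\<^sub>R u + (w \<bullet> x) *\<^sub>R w)
    + sin t *\<^sub>R ((u \<bullet> x) *\<^sub>R w - (w \<bullet> x) *\<^sub>R u))"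

lemma plane_rotation_mult:
  "plane_rotation u w t *v x = x
    + (cos t - 1) *\<^sub>R ((u \<bullet> x) *\<^sub>R u + (w \<bullet> x) *\<^sub>R w)
    + sin t *\<^sub>R ((u \<bullet> x) *\<^sub>R w - (w \<bullet> x) *\<^sub>R u)"
proof -
  have "linear (\<lambda>x. x
    + (cos t - 1) *\<^sub>R ((u \<bullet> x) *\<^sub>R u + (w \<bullet> x) *\<^sub>R w)
    + sin t *\<^sub>R ((u \<bullet> x) *\<^sub>R w - (w \<bullet> x) *\<^sub>R u))"
    by (rule linearI) (simp_all add: inner_add_right algebra_simps)
  then show ?thesis
    unfolding plane_rotation_def by (simp add: matrix_works)
qed

lemma continuous_on_plane_rotation: "continuous_on T (plane_rotation u w)"
  unfolding plane_rotation_def matrix_def by (intro continuous_intros)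

lemma plane_rotation_fixes:
  "u \<bullet> x = 0 \<Longrightarrow> w \<bullet> x = 0 \<Longrightarrow> plane_rotation u w t *v x = x"
  by (simp add: plane_rotation_mult)

context
  fixes u w :: "real^'n"
  assumes norm_u: "norm u = 1" and norm_w: "norm w = 1" and orth: "u \<bullet> w = 0"
begin

lemma orthonormal_inner: "u \<bullet> u = 1" "w \<bullet> w = 1" "u \<bullet> w = 0" "w \<bullet> u = 0"
  using norm_u norm_w orth by (simp_all add: norm_eq_1 inner_commute)

text \<open>Recovers the cosine of the angle from the matrix. This separates different angles in
  \<open>{0..pi}\<close> and detects possible synchronization.\<close>

lemma plane_rotation_inner: "(plane_rotation u w t *v u) \<bullet> u = cos t"
  by (simp add: plane_rotation_mult orthonormal_inner inner_add_left inner_diff_left algebra_simps)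

lemma plane_rotation_add:
  "plane_rotation u w s ** plane_rotation u w t = plane_rotation u w (s + t)"
proof -
  have "plane_rotation u w s *v (plane_rotation u w t *v x) = plane_rotation u w (s + t) *v x" for x
    by (simp add: plane_rotation_mult orthonormal_inner inner_add_right inner_diff_right
        cos_add sin_add algebra_simps)
  then show ?thesis
    by (simp add: matrix_eq matrix_vector_mul_assoc[symmetric])
qed

text \<open>The rotation by \<open>- t\<close> is the adjoint of the rotation by \<open>t\<close>
  and, by the addition law, also its inverse.\<close>

lemma orthogonal_plane_rotation: "orthogonal_matrix (plane_rotation u w t)"
proof -
  have "x \<bullet> (plane_rotation u w (- t) *v z) = (plane_rotation u w t *v x) \<bullet> z" for x z
    by (simp add: plane_rotation_mult inner_add_right inner_diff_right inner_add_left
        inner_diff_left inner_commute algebra_simps)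
  then have "(plane_rotation u w t *v x) \<bullet> (plane_rotation u w t *v z)
      = x \<bullet> ((plane_rotation u w (- t) ** plane_rotation u w t) *v z)" for x z
    by (metis matrix_vector_mul_assoc)
  moreover have "plane_rotation u w (- t) ** plane_rotation u w t = mat 1"
    by (simp add: plane_rotation_add matrix_eq plane_rotation_mult)
  ultimately have "orthogonal_transformation ((*v) (plane_rotation u w t))"
    by (simp add: orthogonal_transformation_def matrix_vector_mul_linear)
  then show ?thesis
    by (simp add: orthogonal_transformation_matrix)
qed

text \<open>The determinant is \<open>1\<close> because the matrix is the square of the rotation by \<open>t / 2\<close>.\<close>

lemma rotation_plane_rotation: "rotation_matrix (plane_rotation u w t)"
proof -
  let ?H = "plane_rotation u w (t / 2)"
  have "det (plane_rotation u w t) = det ?H * det ?H"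
    using plane_rotation_add[of "t / 2" "t / 2"] by (metis det_mul field_sum_of_halves)
  also have "\<dots> = 1"
    using det_orthogonal_matrix[OF orthogonal_plane_rotation[of "t / 2"]] by auto
  finally show ?thesis
    by (simp add: rotation_matrix_def orthogonal_plane_rotation)
qed

end

section \<open>Outputs compared vertex by vertex\<close>

lemma rotation_mult_cancel:
  fixes Q :: "real^'n^'n"
  assumes "rotation_matrix Q" "A ** Q = B"
  shows "A = B ** transpose Q"
  using assms by (metis matrix_mul_assoc matrix_mul_rid orthogonal_matrix_def rotation_matrix_def)

text \<open>Outside \<open>darts E\<close> all outputs are \<open>undefined\<close>, so only darts
  matter. Grouping them by their first vertex turns equality of outputs into separate conditions at
  the vertices.\<close>

lemma output_SO_eq_iff:
  "output_SO E y P = output_SO E y Q \<longleftrightarrow>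
    (\<forall>i. \<forall>v\<in>y i ` neighbours E i. transpose (P $ i) *v v = transpose (Q $ i) *v v)"
proof -
  have "output_SO E y P = output_SO E y Q \<longleftrightarrow>
    (\<forall>d\<in>darts E. output_SO E y P d = output_SO E y Q d)"
    by (auto simp: output_SO_def restrict_def fun_eq_iff)
  also have "\<dots> \<longleftrightarrow>
    (\<forall>i. \<forall>v\<in>y i ` neighbours E i. transpose (P $ i) *v v = transpose (Q $ i) *v v)"
    by (auto simp: output_SO_def darts_def neighbours_def simp del: transpose_matrix_vector)
  finally show ?thesis .
qed

lemma output_R_eq_iff:
  "output_R E y x = output_R E y z \<longleftrightarrow> (\<forall>i. \<forall>v\<in>y i ` neighbours E i. x $ i \<bullet> v = z $ i \<bullet> v)"
proof -
  have "output_R E y x = output_R E y z \<longleftrightarrow>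
    (\<forall>d\<in>darts E. output_R E y x d = output_R E y z d)"
    by (auto simp: output_R_def restrict_def fun_eq_iff)
  also have "\<dots> \<longleftrightarrow> (\<forall>i. \<forall>v\<in>y i ` neighbours E i. x $ i \<bullet> v = z $ i \<bullet> v)"
    by (auto simp: output_R_def darts_def neighbours_def)
  finally show ?thesis .
qed

text \<open>Output synchronization can be read off the output: it says that the components
  \<open>(i, j)\<close> and \<open>(j, i)\<close> coincide. The symmetry of \<open>y\<close> enters
  because the latter is formed with \<open>y j i\<close>.\<close>

lemma output_sync_cong:
  assumes sym: "\<And>i j. {i, j} \<in> E \<Longrightarrow> y i j = y j i"
    and Q: "Q \<in> output_sync E y" and P: "P \<in> SO_states"
    and eq: "output_SO E y P = output_SO E y Q"
  shows "P \<in> output_sync E y"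
proof -
  have "transpose (P $ i) *v y i j = transpose (P $ j) *v y i j" if "{i, j} \<in> E" for i j
  proof -
    have ji: "{j, i} \<in> E"
      using that by (simp add: insert_commute)
    have "transpose (P $ i) *v y i j = transpose (Q $ i) *v y i j"
      "transpose (P $ j) *v y j i = transpose (Q $ j) *v y j i"
      using eq that ji unfolding output_SO_eq_iff neighbours_def by blast+
    moreover have "transpose (Q $ i) *v y i j = transpose (Q $ j) *v y i j"
      using Q that unfolding output_sync_def by blast
    ultimately show ?thesis
      using sym[OF that] by metis
  qed
  then show ?thesis
    using P unfolding output_sync_def by blast
qed

lemma inj_on_output_SO:
  fixes y :: "'k::finite \<Rightarrow> 'k \<Rightarrow> real^'n"
  assumes "\<And>i. CARD('n) - 1 \<le> dim (y i ` neighbours E i)"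
  shows "inj_on (output_SO E y) SO_states"
proof (rule inj_onI)
  fix P Q
  assume P: "P \<in> SO_states" and Q: "Q \<in> SO_states"
    and eq: "output_SO E y P = output_SO E y Q"
  have "P $ i = Q $ i" for i
  proof -
    have rot: "rotation_matrix (P $ i)" "rotation_matrix (Q $ i)"
      using P Q by (auto simp: SO_states_def)
    have "(Q $ i ** transpose (P $ i)) *v v = v" if "v \<in> y i ` neighbours E i" for v
    proof -
      have "transpose (P $ i) *v v = transpose (Q $ i) *v v"
        using eq that unfolding output_SO_eq_iff by blast
      then show ?thesis
        using rot(2) by (metis matrix_vector_mul_assoc matrix_vector_mul_lid
            orthogonal_matrix_def rotation_matrix_def)
    qed
    then have "Q $ i ** transpose (P $ i) = mat 1"
      using rot assms
      by (intro rotation_fixes_codim_1_eq_id[of _ "y i ` neighbours E i"]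
          rotation_matrix_mult rotation_matrix_transpose) auto
    then show ?thesis
      using rotation_mult_cancel[OF rotation_matrix_transpose[OF rot(1)], of "Q $ i" "mat 1"]
      by simp
  qed
  then show "P = Q"
    by (simp add: vec_eq_iff)
qed

text \<open>If the vectors at \<open>i\<close> do not span, a state equal to a unit normal at
  \<open>i\<close> and zero elsewhere has the output of the zero state. If they span everywhere, the
  difference of two states with equal outputs is at each vertex orthogonal to the whole
  space.\<close>

lemma inj_output_R_iff:
  fixes y :: "'k::finite \<Rightarrow> 'k \<Rightarrow> real^'n"
  shows "inj (output_R E y) \<longleftrightarrow> (\<forall>i. CARD('n) \<le> dim (y i ` neighbours E i))"
proof
  assume inj: "inj (output_R E y)"
  show "\<forall>i. CARD('n) \<le> dim (y i ` neighbours E i)"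
  proof (rule ccontr)
    assume "\<not> ?thesis"
    then obtain i where "dim (y i ` neighbours E i) < CARD('n)"
      by (auto simp: not_le)
    then obtain u where u: "norm u = 1" "\<And>v. v \<in> y i ` neighbours E i \<Longrightarrow> u \<bullet> v = 0"
      using exists_unit_orthogonal by blast
    have "output_R E y (axis i u) = output_R E y 0"
      unfolding output_R_eq_iff using u(2) by (auto simp: axis_def)
    then have "axis i u = 0"
      using inj by (simp add: inj_eq)
    then show False
      using u(1) by simp
  qed
next
  assume dim: "\<forall>i. CARD('n) \<le> dim (y i ` neighbours E i)"
  show "inj (output_R E y)"
  proof (rule injI)
    fix x z
    assume eq: "output_R E y x = output_R E y z"
    have "x $ i = z $ i" for i
    proof -
      have "span (y i ` neighbours E i) = UNIV"
        using dim by (simp add: span_eq_UNIV_if_dim)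
      moreover have "orthogonal (x $ i - z $ i) v" if "v \<in> y i ` neighbours E i" for v
        using eq that unfolding output_R_eq_iff orthogonal_def by (auto simp: inner_diff_left)
      ultimately have "orthogonal (x $ i - z $ i) (x $ i - z $ i)"
        by (metis UNIV_I orthogonal_to_span)
      then show ?thesis
        by (simp add: orthogonal_self)
    qed
    then show "x = z"
      by (simp add: vec_eq_iff)
  qed
qed

section \<open>A continuum of states with the same output\<close>

text \<open>The set \<open>S\<close> is the injective continuous image of a compact interval of
  angles. The strict bound \<open>dim\<close> forces \<open>CARD('n)\<close> to be at least 2, so
  the truncated subtraction is harmless.\<close>

lemma continuum_of_outputs:
  fixes E :: "'k::finite set set" and y :: "'k \<Rightarrow> 'k \<Rightarrow> real^'n"
  assumes k: "CARD('k) > 1"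
    and sym: "\<And>i j. {i, j} \<in> E \<Longrightarrow> y i j = y j i"
    and dim: "dim (y i ` neighbours E i) < CARD('n) - 1"
    and Q: "Q \<in> output_sync E y"
  obtains S where "S \<subseteq> output_sync E y - state_sync" "compact S" "connected S"
    "S \<approx> (UNIV :: real set)" "\<And>P. P \<in> S \<Longrightarrow> output_SO E y P = output_SO E y Q"
proof -
  let ?V = "y i ` neighbours E i"
  have "dim ?V < CARD('n)"
    using dim by linarith
  then obtain u where u: "norm u = 1" "\<And>v. v \<in> ?V \<Longrightarrow> u \<bullet> v = 0"
    using exists_unit_orthogonal by blast
  \<comment> \<open>Adding \<open>u\<close> uses up only one of the two missing dimensions, so a
    second normal exists that is also orthogonal to \<open>u\<close>.\<close>
  have "dim (insert u ?V) \<le> dim ?V + 1"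
    by (simp add: dim_insert)
  then have "dim (insert u ?V) < CARD('n)"
    using dim by linarith
  then obtain w where w: "norm w = 1" "\<And>v. v \<in> insert u ?V \<Longrightarrow> w \<bullet> v = 0"
    using exists_unit_orthogonal by blast
  have uw: "u \<bullet> w = 0"
    using w(2)[of u] by (simp add: inner_commute)
  have rotQ: "rotation_matrix (Q $ j)" for j
    using Q by (auto simp: output_sync_def SO_states_def)
  let ?R = "plane_rotation u w"
  note rotR = rotation_plane_rotation[OF u(1) w(1) uw]
  define P where "P t = (\<chi> j. if j = i then ?R t ** Q $ i else Q $ j)" for t
  have P_state: "P t \<in> SO_states" for t
    using rotQ rotR by (auto simp: SO_states_def P_def intro: rotation_matrix_mult)
  have P_output: "output_SO E y (P t) = output_SO E y Q" for t
  proof -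
    have "transpose (?R t ** Q $ i) *v v = transpose (Q $ i) *v v" if "v \<in> ?V" for v
    proof -
      have "transpose (?R t) *v (?R t *v v) = v"
        using rotR[of t] by (metis matrix_vector_mul_assoc matrix_vector_mul_lid
            orthogonal_matrix_def rotation_matrix_def)
      moreover have "?R t *v v = v"
        using u(2) w(2) that by (simp add: plane_rotation_fixes)
      ultimately show ?thesis
        by (simp add: matrix_transpose_mul matrix_vector_mul_assoc[symmetric]
            del: transpose_matrix_vector)
    qed
    then show ?thesis
      unfolding output_SO_eq_iff by (simp add: P_def del: transpose_matrix_vector)
  qed
  \<comment> \<open>A second vertex supplies the unchanged matrix with which the rotated one is
    compared.\<close>
  have "UNIV \<noteq> {i}"
    using k by (metis card_1_singleton_iff less_irrefl One_nat_def)
  then obtain j where j: "j \<noteq> i"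
    by blast
  have R_cos: "cos t = (A ** transpose (Q $ i) *v u) \<bullet> u" if "?R t ** Q $ i = A" for t A
    by (simp add: rotation_mult_cancel[OF rotQ that, symmetric] plane_rotation_inner[OF u(1) w(1) uw])
  \<comment> \<open>The only value that \<open>cos t\<close> can take if the rotated matrix at
    \<open>i\<close> equals \<open>Q $ j\<close>.\<close>
  define m where "m = (Q $ j ** transpose (Q $ i) *v u) \<bullet> u"
  have P_sync: "cos t = m" if "P t \<in> state_sync" for t
  proof -
    have "P t $ i = P t $ j"
      using that by (auto simp: state_sync_def)
    then show ?thesis
      using j R_cos by (simp add: P_def m_def)
  qed
  \<comment> \<open>The cosine has a constant sign on either interval, so one of them avoids the value \<open>m\<close>.\<close>
  obtain a b :: real where ab: "a < b" "{a..b} \<subseteq> {0..pi}" "\<And>t. t \<in> {a..b} \<Longrightarrow> cos t \<noteq> m"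
  proof (cases "m \<le> 0")
    case True
    have "cos t > 0" if "t \<in> {0..1}" for t :: real
      using that pi_gt3 by (intro cos_gt_zero_pi) auto
    then have "cos t \<noteq> m" if "t \<in> {0..1}" for t :: real
      using True that by fastforce
    then show ?thesis
      using pi_gt3 by (intro that[of 0 1]) auto
  next
    case False
    have "cos t < 0" if "t \<in> {2..3}" for t :: real
    proof -
      \<comment> \<open>For \<open>t\<close> between 2 and 3, the bounds \<open>3 < pi\<close> and
        \<open>pi < 4\<close> put \<open>pi - t\<close> strictly between \<open>0\<close> and
        \<open>pi / 2\<close>.\<close>
      have "cos (pi - t) > 0"
        using that pi_gt3 pi_less_4 by (intro cos_gt_zero_pi) auto
      then show ?thesis
        by simp
    qed
    then have "cos t \<noteq> m" if "t \<in> {2..3}" for t :: real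
      using False that by fastforce
    then show ?thesis
      using pi_gt3 by (intro that[of 2 3]) auto
  qed
  \<comment> \<open>The matrix at \<open>i\<close> determines the cosine of the angle, and the
    cosine is injective on \<open>{0..pi}\<close>, which contains the interval.\<close>
  have inj: "inj_on P {a..b}"
  proof (rule inj_onI)
    fix s t
    assume st: "s \<in> {a..b}" "t \<in> {a..b}" and "P s = P t"
    then have "P s $ i = P t $ i"
      by simp
    then have "cos s = cos t"
      using R_cos[of s] R_cos[of t] by (simp add: P_def)
    moreover have "s \<in> {0..pi}" "t \<in> {0..pi}"
      using st ab(2) by blast+
    ultimately show "s = t"
      by (simp add: cos_inj_pi)
  qed
  have cont: "continuous_on {a..b} P"
  proof -
    have comp: "continuous_on {a..b} (\<lambda>t. ?R t ** Q $ i)"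
      unfolding matrix_matrix_mult_def
      by (intro continuous_intros continuous_on_plane_rotation)
    have "continuous_on {a..b} (\<lambda>t. if j = i then ?R t ** Q $ i else Q $ j)" for j
      using comp by (cases "j = i") simp_all
    then show ?thesis
      unfolding P_def by (intro continuous_on_vec_lambda)
  qed
  show ?thesis
  proof (rule that[of "P ` {a..b}"])
    show "P ` {a..b} \<approx> (UNIV :: real set)"
      using inj_on_image_eqpoll_self[OF inj]
      by (rule eqpoll_trans) (simp add: closed_interval_eqpoll_reals ab(1))
    show "P ` {a..b} \<subseteq> output_sync E y - state_sync"
      using P_sync ab(3) output_sync_cong[OF sym Q P_state P_output] by blast
    show "compact (P ` {a..b})"
      using cont by (intro compact_continuous_image) auto
    show "connected (P ` {a..b})"
      using cont by (intro connected_continuous_image) auto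
  qed (auto simp: P_output)
qed

section \<open>Injectivity on rotations and the final equivalences\<close>

lemma state_sync_subset_output_sync:
  fixes y :: "'k::finite \<Rightarrow> 'k \<Rightarrow> real^'n"
  shows "state_sync \<subseteq> output_sync E y"
proof
  fix Q :: "(real^'n^'n)^'k"
  assume Q: "Q \<in> state_sync"
  then have "Q $ i = Q $ j" for i j
    by (auto simp: state_sync_def)
  then have "transpose (Q $ i) *v v = transpose (Q $ j) *v v" for i j v
    by metis
  then show "Q \<in> output_sync E y"
    using Q by (auto simp: state_sync_def output_sync_def simp del: transpose_matrix_vector)
qed

text \<open>For necessity, the continuum is built around the state with all matrices equal to the
  identity. Any member has the same output but is not synchronized, hence is a different
  state.\<close>

lemma inj_on_output_SO_iff:
  fixes E :: "'k::finite set set" and y :: "'k \<Rightarrow> 'k \<Rightarrow> real^'n"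
  assumes k: "CARD('k) > 1"
    and sym: "\<And>i j. {i, j} \<in> E \<Longrightarrow> y i j = y j i"
  shows "inj_on (output_SO E y) SO_states \<longleftrightarrow>
    (\<forall>i. CARD('n) - 1 \<le> dim (y i ` neighbours E i))"
proof
  assume inj: "inj_on (output_SO E y) SO_states"
  show "\<forall>i. CARD('n) - 1 \<le> dim (y i ` neighbours E i)"
  proof (rule ccontr)
    assume "\<not> ?thesis"
    then obtain i where i: "dim (y i ` neighbours E i) < CARD('n) - 1"
      by (auto simp: not_le)
    let ?I = "(\<chi> j. mat 1) :: (real^'n^'n)^'k"
    have sync: "?I \<in> state_sync"
      by (simp add: state_sync_def SO_states_def rotation_matrix_def orthogonal_matrix_id)
    then have "?I \<in> output_sync E y"
      using state_sync_subset_output_sync by blast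
    then obtain S where S: "S \<subseteq> output_sync E y - state_sync" "S \<approx> (UNIV :: real set)"
      "\<And>P. P \<in> S \<Longrightarrow> output_SO E y P = output_SO E y ?I"
      using continuum_of_outputs[OF k sym i] by metis
    obtain P where P: "P \<in> S"
      using S(2) by (metis UNIV_not_empty all_not_in_conv eqpoll_empty_iff_empty eqpoll_sym)
    then have "P \<in> SO_states"
      using S(1) by (auto simp: output_sync_def)
    then have "P = ?I"
      using inj S(3)[OF P] sync by (auto simp: inj_on_def state_sync_def)
    then show False
      using P S(1) sync by blast
  qed
qed (use inj_on_output_SO in blast)

theorem theorem1:
  fixes E :: "'k::finite set set"
    and y :: "'k \<Rightarrow> 'k \<Rightarrow> real^'n"
  assumes "simple_graph E"
    and "CARD('k) > 2"
    and "\<And>i j. {i, j} \<in> E \<Longrightarrow> y i j = y j i"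
    and "\<And>i j. {i, j} \<in> E \<Longrightarrow> y i j \<in> sphere 0 1"
  shows "(CARD('n) \<ge> 2 \<longrightarrow>
      (inj_on (output_SO E y) SO_states \<longleftrightarrow> (\<forall>i. has_indep_vectors E y (CARD('n) - 1) i))) \<and>
    (inj (output_R E y) \<longleftrightarrow> (\<forall>i. has_indep_vectors E y CARD('n) i)) \<and>
    (CARD('n) \<ge> 2 \<and> \<not> inj_on (output_SO E y) SO_states \<longrightarrow>
      (\<forall>Q\<in>output_sync E y. \<exists>S \<subseteq> output_sync E y - state_sync.
        compact S \<and> connected S \<and> S \<approx> (UNIV :: real set) \<and>
        (\<forall>P\<in>S. output_SO E y P = output_SO E y Q)))"
proof -
  have k: "CARD('k) > 1"
    using assms(2) by simp
  have SO_iff: "inj_on (output_SO E y) SO_states \<longleftrightarrow>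
      (\<forall>i. CARD('n) - 1 \<le> dim (y i ` neighbours E i))"
    using k assms(3) by (rule inj_on_output_SO_iff)
  have "\<exists>S \<subseteq> output_sync E y - state_sync.
        compact S \<and> connected S \<and> S \<approx> (UNIV :: real set) \<and>
        (\<forall>P\<in>S. output_SO E y P = output_SO E y Q)"
    if not_inj: "\<not> inj_on (output_SO E y) SO_states" and Q: "Q \<in> output_sync E y" for Q
  proof -
    \<comment> \<open>The deficient vertex depends only on the graph and the reference vectors, so
      it serves every \<open>Q\<close>.\<close>
    obtain i where i: "dim (y i ` neighbours E i) < CARD('n) - 1"
      using not_inj unfolding SO_iff by (meson not_le)
    then show ?thesis
      using continuum_of_outputs[OF k assms(3) i Q] by metis
  qed
  then show ?thesis
    unfolding has_indep_vectors_iff_dim SO_iff inj_output_R_iff by blast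
qed

end
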